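(* The triple $(\Sigma,\vec{\ltimes},\Omega)$, with action $\langle A\rangle\,\vec{\ltimes}\,\bar{x}:=\overline{A\,\vec{\ltimes}\,x}$, is a linear dynamic system. That is, it is both a dynamic system and a linear S-system: (a) it is an S-system of the monoid $(\Sigma,\ltimes)$ on $\Omega$; (b) $\Omega$, with the topology of the distance $d$, is a Hausdorff space, and for each $\langle A\rangle\in\Sigma$ the map $\bar{x}\mapsto\langle A\rangle\,\vec{\ltimes}\,\bar{x}$ from $\Omega$ to $\Omega$ is continuous; (c) both $\Sigma$ and $\Omega$ are vector spaces, and the action is a linear mapping, i.e. $\langle A\rangle\,\vec{\ltimes}\,(a\bar{x}\,\vec{+}\,b\bar{y})=a(\langle A\rangle\,\vec{\ltimes}\,\bar{x})\,\vec{+}\,b(\langle A\rangle\,\vec{\ltimes}\,\bar{y})$ for all $\langle A\rangle\in\Sigma$, $\bar{x},\bar{y}\in\Omega$, $a,b\in\mathbb{R}$.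
   Context: $\mathcal{M}=\bigcup_{m,n\ge1}\mathcal{M}_{m\times n}$ (all real matrices); $\mathcal{V}=\bigcup_{n\ge1}\mathcal{V}_n$, where $\mathcal{V}_n=\mathbb{R}^n$ (column vectors); $\otimes$ is the Kronecker product, $I_k$ the $k\times k$ identity matrix, $\mathbf{1}_k\in\mathbb{R}^k$ the all-ones column. M-product: for $A\in\mathcal{M}_{m\times n}$, $B\in\mathcal{M}_{p\times q}$, $t=\operatorname{lcm}(n,p)$: $A\ltimes B:=(A\otimes I_{t/n})(B\otimes I_{t/p})$. V-product: for $A\in\mathcal{M}_{m\times n}$, $x\in\mathcal{V}_r$, $t=\operatorname{lcm}(n,r)$: $A\,\vec{\ltimes}\,x:=(A\otimes I_{t/n})(x\otimes\mathbf{1}_{t/r})$. V-addition: for $x\in\mathcal{V}_m$, $y\in\mathcal{V}_n$, $t=\operatorname{lcm}(m,n)$: $x\,\vec{+}\,y:=(x\otimes\mathbf{1}_{t/m})+(y\otimes\mathbf{1}_{t/n})$, and $x\,\vec{-}\,y:=x\,\vec{+}\,(-y)$. M-equivalence: $A\sim B$ iff $A\otimes I_\alpha=B\otimes I_\beta$ for some $\alpha,\beta\ge1$; the class of $A$ is $\langle A\rangle$; $\Sigma=\mathcal{M}/\!\sim$ with $\langle A\rangle\ltimes\langle B\rangle:=\langle A\ltimes B\rangle$ is a monoid. Linear structure on matrix classes: for a positive rational $\mu$, let $\mathcal{M}_\mu$ be the set of all $m\times n$ matrices with $m/n=\mu$, and $\Sigma_\mu=\mathcal{M}_\mu/\!\sim$.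 For $A\in\mathcal{M}_{m\times n}$, $B\in\mathcal{M}_{p\times q}$ both in $\mathcal{M}_\mu$ and $t=\operatorname{lcm}(m,p)$, the sum of $\langle A\rangle$ and $\langle B\rangle$ is the class of $(A\otimes I_{t/m})+(B\otimes I_{t/p})$, and $a\langle A\rangle:=\langle aA\rangle$ for $a\in\mathbb{R}$; with these operations each $\Sigma_\mu$ is a vector space. Classes belonging to different $\Sigma_\mu$ are added only formally, as elements of the direct sum $\bigoplus_\mu\Sigma_\mu$ over all positive rationals $\mu$ (the space of formal polynomials), and it is through this formal direct sum that $\Sigma$ is regarded as a vector space. V-equivalence: $x\leftrightarrow y$ iff $x\otimes\mathbf{1}_\alpha=y\otimes\mathbf{1}_\beta$ for some $\alpha,\beta\ge1$; the class of $x$ is $\bar{x}$; $\Omega=\mathcal{V}/\!\leftrightarrow$ with $\bar{x}\,\vec{+}\,\bar{y}:=\overline{x\,\vec{+}\,y}$ and $a\bar{x}:=\overline{ax}$ for $a\in\mathbb{R}$. All operations on classes, including the action, are well defined. Norm and distance: for $x\in\mathcal{V}_m$, $\|x\|_{\mathcal{V}}:=\sqrt{\tfrac1m x^Tx}$; $\|\bar{x}\|_{\mathcal{V}}:=\|x\|_{\mathcal{V}}$ (well defined); $d(\bar{x},\bar{y}):=\|\bar{x}\,\vec{-}\,\bar{y}\|_{\mathcal{V}}$, where $\bar{x}\,\vec{-}\,\bar{y}:=\overline{x\,\vec{-}\,y}$. S-system: a triple $(S,\varphi,X)$ with $(S,* )$ a monoid with identity $e$, $X\neq\emptyset$ and $\varphi:S\times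 X\to X$ satisfying $\varphi(g_1,\varphi(g_2,x))=\varphi(g_1*g_2,x)$ and $\varphi(e,x)=x$ for all $g_1,g_2\in S$, $x\in X$. It is a dynamic system if $X$ is a Hausdorff topological space and, for every $s\in S$, the map $x\mapsto\varphi(s,x)$ is continuous. It is a linear S-system if both $S$ and $X$ are vector spaces and $\varphi$ is a linear mapping, meaning $\varphi(s,ax+by)=a\varphi(s,x)+b\varphi(s,y)$ for all $s\in S$, $x,y\in X$, $a,b\in\mathbb{R}$. *)

theory Defs
  imports
    "HOL-Analysis.Abstract_Metric_Spaces"
    "HOL-Library.FuncSet"
    "HOL-Library.Disjoint_Sets"
    "Jordan_Normal_Form.VS_Connect"
begin

unbundle no vec_syntax
hide_const (open) Finite_Cartesian_Product.vec

section \<open>Matrices and vectors of arbitrary positive dimensions\<close>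

definition all_mats :: "real mat set" where
  "all_mats = {A. dim_row A \<ge> 1 \<and> dim_col A \<ge> 1}"

definition all_vecs :: "real vec set" where
  "all_vecs = {x. dim_vec x \<ge> 1}"

definition kron_mat :: "real mat \<Rightarrow> real mat \<Rightarrow> real mat" (infixl \<open>\<otimes>\<^sub>M\<close> 75) where
  "A \<otimes>\<^sub>M B = mat (dim_row A * dim_row B) (dim_col A * dim_col B)
     (\<lambda>(i, j). A $$ (i div dim_row B, j div dim_col B) * B $$ (i mod dim_row B, j mod dim_col B))"

definition kron_vec :: "real vec \<Rightarrow> real vec \<Rightarrow> real vec" (infixl \<open>\<otimes>\<^sub>V\<close> 75) where
  "x \<otimes>\<^sub>V y = vec (dim_vec x * dim_vec y)
     (\<lambda>i. x $ (i div dim_vec y) * y $ (i mod dim_vec y))"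

definition ones :: "nat \<Rightarrow> real vec" where
  "ones k = vec k (\<lambda>_. 1)"

definition M_prod :: "real mat \<Rightarrow> real mat \<Rightarrow> real mat" where
  "M_prod A B = (let t = lcm (dim_col A) (dim_row B) in
     (A \<otimes>\<^sub>M 1\<^sub>m (t div dim_col A)) * (B \<otimes>\<^sub>M 1\<^sub>m (t div dim_row B)))"

definition V_prod :: "real mat \<Rightarrow> real vec \<Rightarrow> real vec" where
  "V_prod A x = (let t = lcm (dim_col A) (dim_vec x) in
     (A \<otimes>\<^sub>M 1\<^sub>m (t div dim_col A)) *\<^sub>v (x \<otimes>\<^sub>V ones (t div dim_vec x)))"

text \<open>The following sum is intended for matrices with equal ratio of rows to columns.\<close>

definition M_add :: "real mat \<Rightarrow> real mat \<Rightarrow> real mat" where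
  "M_add A B = (let t = lcm (dim_row A) (dim_row B) in
     (A \<otimes>\<^sub>M 1\<^sub>m (t div dim_row A)) + (B \<otimes>\<^sub>M 1\<^sub>m (t div dim_row B)))"

definition V_add :: "real vec \<Rightarrow> real vec \<Rightarrow> real vec" where
  "V_add x y = (let t = lcm (dim_vec x) (dim_vec y) in
     (x \<otimes>\<^sub>V ones (t div dim_vec x)) + (y \<otimes>\<^sub>V ones (t div dim_vec y)))"

definition V_minus :: "real vec \<Rightarrow> real vec \<Rightarrow> real vec" where
  "V_minus x y = V_add x (- y)"

definition V_norm :: "real vec \<Rightarrow> real" where
  "V_norm x = sqrt (1 / real (dim_vec x) * scalar_prod x x)"

section \<open>Equivalences and operations on classes\<close>

definition M_equiv :: "(real mat \<times> real mat) set" where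
  "M_equiv = {(A, B). A \<in> all_mats \<and> B \<in> all_mats \<and>
     (\<exists>\<alpha>\<ge>1. \<exists>\<beta>\<ge>1. A \<otimes>\<^sub>M 1\<^sub>m \<alpha> = B \<otimes>\<^sub>M 1\<^sub>m \<beta>)}"

definition V_equiv :: "(real vec \<times> real vec) set" where
  "V_equiv = {(x, y). x \<in> all_vecs \<and> y \<in> all_vecs \<and>
     (\<exists>\<alpha>\<ge>1. \<exists>\<beta>\<ge>1. x \<otimes>\<^sub>V ones \<alpha> = y \<otimes>\<^sub>V ones \<beta>)}"

text \<open>
  Operations on classes are the unions, over all choices of representatives, of the classes
  of the results.  Such a union is itself an equivalence class exactly when the
  operation is independent of the representatives, so the closure requirements below
  include well-definedness.
\<close>

definition lift_class :: "('b \<times> 'b) set \<Rightarrow> ('a \<Rightarrow> 'b) \<Rightarrow> 'a set \<Rightarrow> 'b set" where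
  "lift_class r f P = (\<Union>a\<in>P. r `` {f a})"

definition lift_class2 ::
    "('c \<times> 'c) set \<Rightarrow> ('a \<Rightarrow> 'b \<Rightarrow> 'c) \<Rightarrow> 'a set \<Rightarrow> 'b set \<Rightarrow> 'c set" where
  "lift_class2 r f P Q = (\<Union>a\<in>P. \<Union>b\<in>Q. r `` {f a b})"

definition Sigma_monoid :: "real mat set monoid" where
  "Sigma_monoid = \<lparr>carrier = all_mats // M_equiv,
     mult = lift_class2 M_equiv M_prod,
     one = M_equiv `` {1\<^sub>m 1}\<rparr>"

definition mats_ratio :: "rat \<Rightarrow> real mat set" where
  "mats_ratio \<mu> = {A \<in> all_mats. of_nat (dim_row A) / of_nat (dim_col A) = \<mu>}"

text \<open>
  The ring multiplication fields of a module record play no role for vector spaces.  The zero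
  of the space below is the common class of all zero matrices whose ratio is \<open>\<mu>\<close>.
\<close>

definition Sigma_ratio :: "rat \<Rightarrow> (real, real mat set) module" where
  "Sigma_ratio \<mu> = \<lparr>carrier = mats_ratio \<mu> // M_equiv,
     mult = undefined, one = undefined,
     zero = \<Union>{M_equiv `` {0\<^sub>m m n} | m n. 0\<^sub>m m n \<in> mats_ratio \<mu>},
     add = lift_class2 M_equiv M_add,
     smult = (\<lambda>a. lift_class M_equiv (\<lambda>A. a \<cdot>\<^sub>m A))\<rparr>"

definition Omega :: "(real, real vec set) module" where
  "Omega = \<lparr>carrier = all_vecs // V_equiv,
     mult = undefined, one = undefined,
     zero = V_equiv `` {0\<^sub>v 1},
     add = lift_class2 V_equiv V_add,
     smult = (\<lambda>a. lift_class V_equiv (\<lambda>x. a \<cdot>\<^sub>v x))\<rparr>"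

definition action :: "real mat set \<Rightarrow> real vec set \<Rightarrow> real vec set" where
  "action = lift_class2 V_equiv V_prod"

text \<open>The norm is constant on each class, so its image of a class is a singleton.\<close>

definition class_norm :: "real vec set \<Rightarrow> real" where
  "class_norm P = the_elem (V_norm ` P)"

text \<open>
  The locale \<open>Metric_space\<close> requires nonnegativity and symmetry of the distance
  on the whole type, hence the value 0 for arguments that are not classes.
\<close>

definition class_dist :: "real vec set \<Rightarrow> real vec set \<Rightarrow> real" where
  "class_dist P Q = (if P \<in> carrier Omega \<and> Q \<in> carrier Omega
     then class_norm (lift_class2 V_equiv V_minus P Q) else 0)"

definition Omega_topology :: "real vec set topology" where
  "Omega_topology = Metric_space.mtopology (carrier Omega) class_dist"

section \<open>Direct sums of families of vector spaces\<close>

definition family_direct_sum ::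
    "'i set \<Rightarrow> ('i \<Rightarrow> ('k, 'v) module) \<Rightarrow> ('k, 'i \<Rightarrow> 'v) module" where
  "family_direct_sum I V = \<lparr>
     carrier = {f \<in> (\<Pi>\<^sub>E i\<in>I. carrier (V i)). finite {i \<in> I. f i \<noteq> \<zero>\<^bsub>V i\<^esub>}},
     mult = undefined, one = undefined,
     zero = (\<lambda>i\<in>I. \<zero>\<^bsub>V i\<^esub>),
     add = (\<lambda>f g. \<lambda>i\<in>I. f i \<oplus>\<^bsub>V i\<^esub> g i),
     smult = (\<lambda>a f. \<lambda>i\<in>I. a \<odot>\<^bsub>V i\<^esub> f i)\<rparr>"

section \<open>S-systems\<close>

definition S_system :: "('s, 'm) monoid_scheme \<Rightarrow> ('s \<Rightarrow> 'x \<Rightarrow> 'x) \<Rightarrow> 'x set \<Rightarrow> bool" where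
  "S_system S \<phi> X \<longleftrightarrow> monoid S \<and> X \<noteq> {} \<and>
     (\<forall>s\<in>carrier S. \<forall>x\<in>X. \<phi> s x \<in> X) \<and>
     (\<forall>g1\<in>carrier S. \<forall>g2\<in>carrier S. \<forall>x\<in>X. \<phi> g1 (\<phi> g2 x) = \<phi> (g1 \<otimes>\<^bsub>S\<^esub> g2) x) \<and>
     (\<forall>x\<in>X. \<phi> \<one>\<^bsub>S\<^esub> x = x)"

definition dynamic_system ::
    "('s, 'm) monoid_scheme \<Rightarrow> ('s \<Rightarrow> 'x \<Rightarrow> 'x) \<Rightarrow> 'x set \<Rightarrow> 'x topology \<Rightarrow> bool" where
  "dynamic_system S \<phi> X T \<longleftrightarrow> S_system S \<phi> X \<and>
     topspace T = X \<and> Hausdorff_space T \<and>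
     (\<forall>s\<in>carrier S. continuous_map T T (\<phi> s))"

text \<open>
  The vector space structure on the monoid is given formally: the monoid is partitioned into
  vector spaces \<open>V i\<close>, whose direct sum is the vector space attached to it.  A monoid that is
  itself a vector space is the case of a one-element index set.  The action is required to be
  linear in its second argument only.
\<close>

definition linear_S_system ::
    "('s, 'm) monoid_scheme \<Rightarrow> 'i set \<Rightarrow> ('i \<Rightarrow> (real, 's) module) \<Rightarrow>
     ('s \<Rightarrow> 'x \<Rightarrow> 'x) \<Rightarrow> (real, 'x) module \<Rightarrow> bool" where
  "linear_S_system S I V \<phi> W \<longleftrightarrow> S_system S \<phi> (carrier W) \<and>
     carrier S = (\<Union>i\<in>I. carrier (V i)) \<and> disjoint_family_on (\<lambda>i. carrier (V i)) I \<and>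
     (\<forall>i\<in>I. vectorspace class_ring (V i)) \<and>
     vectorspace class_ring (family_direct_sum I V) \<and>
     vectorspace class_ring W \<and>
     (\<forall>s\<in>carrier S. \<forall>x\<in>carrier W. \<forall>y\<in>carrier W. \<forall>a b.
        \<phi> s (a \<odot>\<^bsub>W\<^esub> x \<oplus>\<^bsub>W\<^esub> b \<odot>\<^bsub>W\<^esub> y) = a \<odot>\<^bsub>W\<^esub> \<phi> s x \<oplus>\<^bsub>W\<^esub> b \<odot>\<^bsub>W\<^esub> \<phi> s y)"

end

theory Submission
  imports Defs
begin

text \<open>
  Both equivalences identify an object with all of its blow-ups by a factor \<open>k\<close>: a matrix \<open>A\<close>
  with \<open>A \<otimes> I\<close>, a vector \<open>x\<close> with \<open>x \<otimes> 1\<close>, where \<open>I\<close> and \<open>1\<close> have size \<open>k\<close>.  Blow-ups compose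
  multiplicatively, so any finite number of classes have representatives whose sizes fit
  together, and all operations of the theorem (both products, both sums, the difference) are
  the ordinary matrix and vector operations applied to such representatives.  The ordinary
  operations commute with blow-ups; this makes the operations on classes well defined, and
  it makes the size of the chosen representatives immaterial (\<open>f_class\<close> and
  \<open>lift_matched\<close>).  Every algebraic law of the theorem is then the corresponding law for matrices
  and vectors of fixed size: associativity of the matrix product gives the monoid and the
  action, distributivity gives linearity of the action, and the laws of the spaces of
  \<open>m\<close> by \<open>n\<close> matrices and of vectors of length \<open>n\<close> give the vector spaces, which are direct
  limits of these along the blow-ups (\<open>quotient_vectorspace\<close>).

  For the topology, the norm is invariant under blow-ups because it averages the squares of
  the entries, so on any finite set of classes the distance is the usual Euclidean one up to scaling.
  A class of matrices acts on vectors of larger and larger size through \<open>A \<otimes> I\<close>, and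
  continuity needs one operator bound for all of these sizes.  It exists because
  \<open>A \<otimes> I\<close> consists of \<open>k\<close> independent copies of \<open>A\<close>, acting on interleaved subvectors
  (\<open>V_norm_kron_id_mult_le\<close>); hence the action is Lipschitz.
\<close>

section \<open>Quotients by blow-ups\<close>

lemma UN_eq_const: "x \<in> A \<Longrightarrow> (\<And>y. y \<in> A \<Longrightarrow> F y = C) \<Longrightarrow> (\<Union>y\<in>A. F y) = C"
  by auto

text \<open>
  The maps \<open>e x k\<close> are the blow-ups.  The relation \<open>r\<close> is described only on \<open>U\<close>, and \<open>U\<close> is saturated:
  in this form one and the same relation on all matrices serves both for the set of all matrices
  and for the subsets of matrices with a fixed ratio of rows to columns.
\<close>

locale expansion =
  fixes U :: "'a set" and e :: "'a \<Rightarrow> nat \<Rightarrow> 'a" and r :: "('a \<times> 'a) set"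
  assumes e_closed: "\<And>x k. x \<in> U \<Longrightarrow> 0 < k \<Longrightarrow> e x k \<in> U"
    and e_e: "\<And>x a b. x \<in> U \<Longrightarrow> e (e x a) b = e x (a * b)"
    and e_1: "\<And>x. x \<in> U \<Longrightarrow> e x 1 = x"
    and rel: "\<And>x y. x \<in> U \<Longrightarrow> (x, y) \<in> r \<longleftrightarrow> y \<in> U \<and> (\<exists>\<alpha>>0. \<exists>\<beta>>0. e x \<alpha> = e y \<beta>)"
begin

lemma rel_refl: "x \<in> U \<Longrightarrow> (x, x) \<in> r"
  by (auto simp: rel)

lemma rel_in: "x \<in> U \<Longrightarrow> (x, y) \<in> r \<Longrightarrow> y \<in> U"
  by (auto simp: rel)

lemma rel_sym: "x \<in> U \<Longrightarrow> (x, y) \<in> r \<Longrightarrow> (y, x) \<in> r"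
  by (metis rel)

lemma rel_trans:
  assumes x: "x \<in> U" and xy: "(x, y) \<in> r" and yz: "(y, z) \<in> r"
  shows "(x, z) \<in> r"
proof -
  have y: "y \<in> U" and z: "z \<in> U"
    using assms rel_in by blast+
  obtain a b where ab: "0 < a" "0 < b" "e x a = e y b"
    using x xy rel by blast
  obtain c d where cd: "0 < c" "0 < d" "e y c = e z d"
    using y yz rel by blast
  have "e x (a * c) = e (e y b) c"
    using x by (simp add: e_e flip: ab(3))
  also have "\<dots> = e (e y c) b"
    using y by (simp add: e_e mult.commute)
  also have "\<dots> = e z (d * b)"
    using z by (simp add: cd(3) e_e)
  finally show ?thesis
    using x z ab cd rel by (metis nat_0_less_mult_iff)
qed

lemma class_eq: "x \<in> U \<Longrightarrow> (x, y) \<in> r \<Longrightarrow> r `` {x} = r `` {y}"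
  by (meson rel_in rel_sym rel_trans equalityI subsetI Image_singleton_iff)

lemma class_eq_iff: "x \<in> U \<Longrightarrow> y \<in> U \<Longrightarrow> r `` {x} = r `` {y} \<longleftrightarrow> (x, y) \<in> r"
  using class_eq rel_refl by blast

lemma class_expand:
  assumes x: "x \<in> U" and k: "0 < k"
  shows "r `` {e x k} = r `` {x}"
proof -
  have "e x k = e (e x k) 1"
    using e_1[OF e_closed[OF assms]] by simp
  then have "(x, e x k) \<in> r"
    unfolding rel[OF x] using e_closed[OF assms] k by (metis less_numeral_extra(1))
  then show ?thesis
    using class_eq[OF x] by simp
qed

lemma class_in: "x \<in> U \<Longrightarrow> r `` {x} \<in> U // r"
  by (rule quotientI)

lemma lift_class_eq:
  assumes x: "x \<in> U"
    and cong: "\<And>y. (x, y) \<in> r \<Longrightarrow> s `` {h y} = s `` {h x}"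
  shows "lift_class s h (r `` {x}) = s `` {h x}"
proof -
  have "x \<in> r `` {x}" using rel_refl[OF x] by simp
  moreover have "s `` {h y} = s `` {h x}" if "y \<in> r `` {x}" for y using cong that by simp
  ultimately show ?thesis
    unfolding lift_class_def by (intro UN_eq_const)
qed

end

text \<open>
  The operation \<open>g\<close> is only meaningful when the sizes \<open>d1 x\<close> and \<open>d2 y\<close> agree; \<open>f\<close> extends it to
  all pairs by blowing both arguments up to the least common multiple of their sizes.
  The three carriers may differ, so that products of matrices with vectors are covered, and the
  sizes may be different functions on the same carrier, as columns and rows are for matrices.
\<close>

locale matched_operation =
  E1: expansion U1 e1 r1 + E2: expansion U2 e2 r2 + E3: expansion U3 e3 r3
  for U1 :: "'a set" and e1 r1 and U2 :: "'b set" and e2 r2 and U3 :: "'c set" and e3 r3 +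
  fixes d1 :: "'a \<Rightarrow> nat" and d2 :: "'b \<Rightarrow> nat"
    and g :: "'a \<Rightarrow> 'b \<Rightarrow> 'c" and f :: "'a \<Rightarrow> 'b \<Rightarrow> 'c"
  assumes d1_pos: "\<And>x. x \<in> U1 \<Longrightarrow> 0 < d1 x"
    and d2_pos: "\<And>y. y \<in> U2 \<Longrightarrow> 0 < d2 y"
    and d1_e: "\<And>x k. x \<in> U1 \<Longrightarrow> d1 (e1 x k) = d1 x * k"
    and d2_e: "\<And>y k. y \<in> U2 \<Longrightarrow> d2 (e2 y k) = d2 y * k"
    and g_closed: "\<And>x y. x \<in> U1 \<Longrightarrow> y \<in> U2 \<Longrightarrow> d1 x = d2 y \<Longrightarrow> g x y \<in> U3"
    and g_e: "\<And>x y k. x \<in> U1 \<Longrightarrow> y \<in> U2 \<Longrightarrow> d1 x = d2 y \<Longrightarrow> 0 < k \<Longrightarrow>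
        g (e1 x k) (e2 y k) = e3 (g x y) k"
    and f_eq: "\<And>x y. x \<in> U1 \<Longrightarrow> y \<in> U2 \<Longrightarrow>
        f x y = g (e1 x (lcm (d1 x) (d2 y) div d1 x)) (e2 y (lcm (d1 x) (d2 y) div d2 y))"
begin

text \<open>
  Any common size may replace the least common multiple: it is a multiple of it,
  so the result is a further blow-up of the original one.
\<close>

lemma f_class:
  assumes x: "x \<in> U1" and y: "y \<in> U2" and "0 < a" "0 < b" and ab: "d1 x * a = d2 y * b"
  shows "r3 `` {f x y} = r3 `` {g (e1 x a) (e2 y b)}"
proof -
  define t where "t = lcm (d1 x) (d2 y)"
  have "t dvd d1 x * a"
    unfolding t_def using ab by (metis dvd_triv_left lcm_least)
  then obtain c where c: "d1 x * a = t * c" ..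
  obtain a' where a': "t = d1 x * a'" unfolding t_def by (meson dvdE dvd_lcm1)
  obtain b' where b': "t = d2 y * b'" unfolding t_def by (meson dvdE dvd_lcm2)
  have p: "0 < d1 x" "0 < d2 y" using d1_pos d2_pos x y by auto
  have a: "a = a' * c" using c a' p by simp
  have b: "b = b' * c" using c ab b' p by simp
  have pos: "0 < a'" "0 < b'" "0 < c" using a b \<open>0 < a\<close> \<open>0 < b\<close> by auto
  have f: "f x y = g (e1 x a') (e2 y b')"
    using f_eq[OF x y] p a' b' unfolding t_def[symmetric] by (metis nonzero_mult_div_cancel_left not_less0)
  have *: "e1 x a' \<in> U1" "e2 y b' \<in> U2" "d1 (e1 x a') = d2 (e2 y b')"
    using x y pos a' b' by (auto simp: E1.e_closed E2.e_closed d1_e d2_e)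
  have "g (e1 x a) (e2 y b) = e3 (f x y) c"
    using g_e[OF *, of c] x y pos by (simp add: a b f E1.e_e E2.e_e)
  then show ?thesis
    using E3.class_expand[OF g_closed[OF *]] pos by (simp add: f)
qed

text \<open>
  After equivalent arguments are blown up to equal objects, multiplying by the size of the
  other argument makes both pairs fit, and \<open>f_class\<close> applies to each of them.
\<close>

lemma f_cong:
  assumes x: "x \<in> U1" and y: "y \<in> U2" and x': "(x, x') \<in> r1" and y': "(y, y') \<in> r2"
  shows "r3 `` {f x' y'} = r3 `` {f x y}"
proof -
  have in': "x' \<in> U1" "y' \<in> U2" using assms E1.rel_in E2.rel_in by auto
  obtain a a' where a: "0 < a" "0 < a'" "e1 x a = e1 x' a'"
    using E1.rel x x' by blast
  obtain b b' where b: "0 < b" "0 < b'" "e2 y b = e2 y' b'"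
    using E2.rel y y' by blast
  define m n where "m = d1 (e1 x a)" and "n = d2 (e2 y b)"
  have m: "m = d1 x * a" "m = d1 x' * a'" by (simp add: m_def x d1_e, simp add: m_def a(3) in' d1_e)
  have n: "n = d2 y * b" "n = d2 y' * b'" by (simp add: n_def y d2_e, simp add: n_def b(3) in' d2_e)
  have pos: "0 < m" "0 < n" using m n a b x y d1_pos d2_pos by auto
  have eq: "d1 x * (a * n) = d2 y * (b * m)" "d1 x' * (a' * n) = d2 y' * (b' * m)"
    by (metis m(1) n(1) mult.assoc mult.commute) (metis m(2) n(2) mult.assoc mult.commute)
  have "r3 `` {f x y} = r3 `` {g (e1 x (a * n)) (e2 y (b * m))}"
    using f_class[OF x y _ _ eq(1)] a b pos by simp
  also have "\<dots> = r3 `` {g (e1 x' (a' * n)) (e2 y' (b' * m))}"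
    using E1.e_e[OF x, of a n] E1.e_e[OF in'(1), of a' n]
      E2.e_e[OF y, of b m] E2.e_e[OF in'(2), of b' m] a(3) b(3) by simp
  also have "\<dots> = r3 `` {f x' y'}"
    using f_class[OF in' _ _ eq(2)] a b pos by simp
  finally show ?thesis ..
qed

lemma lift_f:
  assumes "x \<in> U1" "y \<in> U2"
  shows "lift_class2 r3 f (r1 `` {x}) (r2 `` {y}) = r3 `` {f x y}"
proof -
  have "r3 `` {f x' y'} = r3 `` {f x y}" if "x' \<in> r1 `` {x}" "y' \<in> r2 `` {y}" for x' y'
    using f_cong[OF assms] that by simp
  moreover have "x \<in> r1 `` {x}" "y \<in> r2 `` {y}"
    using assms E1.rel_refl E2.rel_refl by auto
  ultimately show ?thesis
    unfolding lift_class2_def by (intro UN_eq_const)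
qed

text \<open>
  The lemma through which all operations on classes are computed: on representatives of
  matching sizes they are the plain operation \<open>g\<close>.
\<close>

lemma lift_matched:
  "x \<in> U1 \<Longrightarrow> y \<in> U2 \<Longrightarrow> d1 x = d2 y \<Longrightarrow>
    lift_class2 r3 f (r1 `` {x}) (r2 `` {y}) = r3 `` {g x y}"
  using lift_f f_class[of x y 1 1] by (simp add: E1.e_1 E2.e_1 flip: One_nat_def)

lemma matched_reps:
  assumes "X \<in> U1 // r1" "Y \<in> U2 // r2"
  obtains x y where "x \<in> U1" "y \<in> U2" "d1 x = d2 y" "X = r1 `` {x}" "Y = r2 `` {y}"
proof -
  obtain x y where xy: "x \<in> U1" "y \<in> U2" "X = r1 `` {x}" "Y = r2 `` {y}"
    using assms by (metis quotientE)
  show thesis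
    using xy d1_pos d2_pos
    by (intro that[of "e1 x (d2 y)" "e2 y (d1 x)"])
       (auto simp: E1.e_closed E2.e_closed E1.class_expand E2.class_expand d1_e d2_e)
qed

lemma lift_closed:
  "X \<in> U1 // r1 \<Longrightarrow> Y \<in> U2 // r2 \<Longrightarrow> lift_class2 r3 f X Y \<in> U3 // r3"
  by (metis matched_reps lift_matched g_closed E3.class_in)

end

text \<open>
  The objects of one size form a vector space and the blow-ups are linear, so the quotient is the
  direct limit of these spaces.  The zero of each fibre enters as \<open>sm 0 x\<close>; since these zeros
  have no common name, it is required that they all lie in one class \<open>Z\<close>.
\<close>

locale expansion_vectorspace =
  matched_operation U e r U e r U e r d d plus_fibre f
  for U :: "'a set" and e r d plus_fibre f +
  fixes sm :: "real \<Rightarrow> 'a \<Rightarrow> 'a" and Z :: "'a set"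
  assumes plus_commute: "\<And>x y. x \<in> U \<Longrightarrow> y \<in> U \<Longrightarrow> d x = d y \<Longrightarrow> plus_fibre x y = plus_fibre y x"
    and plus_assoc: "\<And>x y z. x \<in> U \<Longrightarrow> y \<in> U \<Longrightarrow> z \<in> U \<Longrightarrow> d x = d y \<Longrightarrow> d y = d z \<Longrightarrow>
      plus_fibre (plus_fibre x y) z = plus_fibre x (plus_fibre y z)"
    and d_plus: "\<And>x y. x \<in> U \<Longrightarrow> y \<in> U \<Longrightarrow> d x = d y \<Longrightarrow> d (plus_fibre x y) = d x"
    and sm_closed: "\<And>a x. x \<in> U \<Longrightarrow> sm a x \<in> U"
    and d_sm: "\<And>a x. x \<in> U \<Longrightarrow> d (sm a x) = d x"
    and sm_e: "\<And>a x k. x \<in> U \<Longrightarrow> sm a (e x k) = e (sm a x) k"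
    and sm_plus: "\<And>a x y. x \<in> U \<Longrightarrow> y \<in> U \<Longrightarrow> d x = d y \<Longrightarrow>
      sm a (plus_fibre x y) = plus_fibre (sm a x) (sm a y)"
    and sm_add: "\<And>a b x. x \<in> U \<Longrightarrow> sm (a + b) x = plus_fibre (sm a x) (sm b x)"
    and sm_mult: "\<And>a b x. x \<in> U \<Longrightarrow> sm (a * b) x = sm a (sm b x)"
    and sm_1: "\<And>x. x \<in> U \<Longrightarrow> sm 1 x = x"
    and Z_eq: "\<And>x. x \<in> U \<Longrightarrow> Z = r `` {sm 0 x}"
    and U_nonempty: "U \<noteq> {}"
begin

lemma lift_sm:
  assumes x: "x \<in> U"
  shows "lift_class r (sm a) (r `` {x}) = r `` {sm a x}"
proof (rule E1.lift_class_eq[OF x])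
  fix y assume y: "(x, y) \<in> r"
  with x obtain \<alpha> \<beta> where *: "y \<in> U" "0 < \<alpha>" "0 < \<beta>" "e x \<alpha> = e y \<beta>"
    using E1.rel by auto
  (* scaling commutes with blow-ups, so the same factors witness the equivalence *)
  then have "e (sm a x) \<alpha> = e (sm a y) \<beta>"
    using x sm_e by metis
  with * show "r `` {sm a y} = r `` {sm a x}"
    using x sm_closed E1.class_expand by metis
qed

lemma matched_reps3:
  assumes "X \<in> U // r" "Y \<in> U // r" "W \<in> U // r"
  obtains x y w where "x \<in> U" "y \<in> U" "w \<in> U" "d y = d x" "d w = d x"
    "X = r `` {x}" "Y = r `` {y}" "W = r `` {w}"
proof -
  obtain x y where xy: "x \<in> U" "y \<in> U" "d x = d y" "X = r `` {x}" "Y = r `` {y}"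
    using matched_reps assms by metis
  obtain w where w: "w \<in> U" "W = r `` {w}"
    using assms(3) by (metis quotientE)
  show thesis
    using xy w d1_pos
    by (intro that[of "e x (d w)" "e y (d w)" "e w (d x)"])
       (auto simp: E1.e_closed E1.class_expand d1_e)
qed

lemma quotient_vectorspace:
  "vectorspace class_ring
    \<lparr>carrier = U // r, mult = m, one = u, zero = Z, add = lift_class2 r f,
     smult = (\<lambda>a. lift_class r (sm a))\<rparr>"
  (is "vectorspace _ ?V")
proof -
  note simps = lift_matched sm_closed d_sm g_closed d_plus lift_sm E1.class_in
  have Z: "Z \<in> U // r"
    using U_nonempty Z_eq sm_closed E1.class_in by (metis ex_in_conv)
  have ag: "abelian_group ?V"
  proof (rule abelian_groupI; simp)
    fix X Y assume "X \<in> U // r" "Y \<in> U // r"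
    then obtain x y where xy: "x \<in> U" "y \<in> U" "d x = d y" "X = r `` {x}" "Y = r `` {y}"
      using matched_reps by metis
    show "lift_class2 r f X Y \<in> U // r"
      using xy by (simp add: simps)
    show "lift_class2 r f X Y = lift_class2 r f Y X"
      using xy by (simp add: simps plus_commute)
  next
    fix X Y W assume "X \<in> U // r" "Y \<in> U // r" "W \<in> U // r"
    then obtain x y w where xyw: "x \<in> U" "y \<in> U" "w \<in> U" "d y = d x" "d w = d x"
      "X = r `` {x}" "Y = r `` {y}" "W = r `` {w}"
      by (rule matched_reps3)
    then show "lift_class2 r f (lift_class2 r f X Y) W = lift_class2 r f X (lift_class2 r f Y W)"
      by (simp add: simps plus_assoc)
  next
    fix X assume "X \<in> U // r"
    then obtain x where x: "x \<in> U" "X = r `` {x}" by (metis quotientE)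
    show "lift_class2 r f Z X = X"
      using x sm_add[of x 0 1] by (simp add: Z_eq[OF x(1)] simps sm_1)
    show "\<exists>Y\<in>U // r. lift_class2 r f Y X = Z"
      using x sm_add[of x "-1" 1]
      by (intro bexI[of _ "r `` {sm (-1) x}"]) (simp_all add: Z_eq[OF x(1)] simps sm_1)
  qed (simp add: Z)
  interpret K: field "class_ring :: real ring"
    by (rule class_field)
  have "module class_ring ?V"
  proof (rule module.intro[OF _ ag])
    show "cring (class_ring :: real ring)" ..
    show "module_axioms class_ring ?V"
    proof (unfold_locales, simp_all)
      fix a X assume "X \<in> U // r"
      then obtain x where x: "x \<in> U" "X = r `` {x}" by (metis quotientE)
      then show "lift_class r (sm a) X \<in> U // r"
        by (simp add: simps)
      show "lift_class r (sm (a + b)) X = lift_class2 r f (lift_class r (sm a) X) (lift_class r (sm b) X)" for b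
        using x by (simp add: simps sm_add)
      show "lift_class r (sm (a * b)) X = lift_class r (sm a) (lift_class r (sm b) X)" for b
        using x by (simp add: simps sm_mult)
      show "lift_class r (sm 1) X = X"
        using x by (simp add: simps sm_1)
    next
      fix a X Y assume "X \<in> U // r" "Y \<in> U // r"
      then obtain x y where xy: "x \<in> U" "y \<in> U" "d x = d y" "X = r `` {x}" "Y = r `` {y}"
        using matched_reps by metis
      then show "lift_class r (sm a) (lift_class2 r f X Y) =
          lift_class2 r f (lift_class r (sm a) X) (lift_class r (sm a) Y)"
        by (simp add: simps sm_plus)
    qed
  qed
  then show ?thesis
    unfolding vectorspace_def using class_field by blast
qed

end

section \<open>Kronecker products with identity matrices and all-ones vectors\<close>

lemma dim_kron_id [simp]:
  "dim_row (A \<otimes>\<^sub>M 1\<^sub>m k) = dim_row A * k" "dim_col (A \<otimes>\<^sub>M 1\<^sub>m k) = dim_col A * k"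
  by (simp_all add: kron_mat_def)

lemma index_kron_id:
  assumes "i < dim_row A * k" "j < dim_col A * k"
  shows "(A \<otimes>\<^sub>M 1\<^sub>m k) $$ (i, j) = (if i mod k = j mod k then A $$ (i div k, j div k) else 0)"
proof -
  have "0 < k" using assms by (cases k) auto
  then show ?thesis using assms by (simp add: kron_mat_def)
qed

lemma dim_kron_ones [simp]: "dim_vec (x \<otimes>\<^sub>V ones k) = dim_vec x * k"
  by (simp add: kron_vec_def ones_def)

lemma index_kron_ones:
  assumes "i < dim_vec x * k"
  shows "(x \<otimes>\<^sub>V ones k) $ i = x $ (i div k)"
proof -
  have "0 < k" using assms by (cases k) auto
  then show ?thesis using assms by (simp add: kron_vec_def ones_def)
qed

text \<open>
  The entries off the diagonals of the blocks of a double blow-up vanish at either of two stages;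
  together these conditions on the residues are a single condition modulo the product.
\<close>

lemma mod_mult_eq_iff:
  fixes i j a b :: nat
  shows "i mod (a * b) = j mod (a * b) \<longleftrightarrow>
    i mod b = j mod b \<and> (i div b) mod a = (j div b) mod a"
proof (cases "b = 0")
  case False
  have "i mod (a * b) = b * (i div b mod a) + i mod b" for i
    by (metis mod_mult2_eq mult.commute)
  moreover have "(b * q + i mod b) div b = q" "(b * q + i mod b) mod b = i mod b" for q i
    using False by auto
  ultimately show ?thesis by metis
qed auto

lemma kron_id_kron_id: "A \<otimes>\<^sub>M 1\<^sub>m a \<otimes>\<^sub>M 1\<^sub>m b = A \<otimes>\<^sub>M 1\<^sub>m (a * b)"
proof (rule eq_matI)
  fix i j
  assume "i < dim_row (A \<otimes>\<^sub>M 1\<^sub>m (a * b))" "j < dim_col (A \<otimes>\<^sub>M 1\<^sub>m (a * b))"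
  then have ij: "i < dim_row A * a * b" "j < dim_col A * a * b"
    by (simp_all add: mult.assoc)
  then have "i div b < dim_row A * a" "j div b < dim_col A * a"
    by (simp_all add: less_mult_imp_div_less)
  with ij show "(A \<otimes>\<^sub>M 1\<^sub>m a \<otimes>\<^sub>M 1\<^sub>m b) $$ (i, j) = (A \<otimes>\<^sub>M 1\<^sub>m (a * b)) $$ (i, j)"
    by (simp add: index_kron_id mod_mult_eq_iff mult.assoc)
       (simp add: div_mult2_eq[symmetric] mult.commute)
qed (simp_all add: mult.assoc)

lemma kron_ones_kron_ones: "x \<otimes>\<^sub>V ones a \<otimes>\<^sub>V ones b = x \<otimes>\<^sub>V ones (a * b)"
proof (rule eq_vecI)
  fix i
  assume "i < dim_vec (x \<otimes>\<^sub>V ones (a * b))"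
  then have i: "i < dim_vec x * a * b"
    by (simp add: mult.assoc)
  then have "i div b < dim_vec x * a"
    by (simp add: less_mult_imp_div_less)
  with i show "(x \<otimes>\<^sub>V ones a \<otimes>\<^sub>V ones b) $ i = (x \<otimes>\<^sub>V ones (a * b)) $ i"
    by (simp add: index_kron_ones mult.assoc)
       (simp add: div_mult2_eq[symmetric] mult.commute)
qed (simp add: mult.assoc)

lemma kron_id_1: "A \<otimes>\<^sub>M 1\<^sub>m 1 = A"
  by (rule eq_matI) (simp_all add: index_kron_id)

lemma kron_ones_1: "x \<otimes>\<^sub>V ones 1 = x"
  by (rule eq_vecI) (simp_all add: index_kron_ones)

lemma mult_add_less:
  fixes p s k n :: nat
  assumes "p < n" "s < k"
  shows "p * k + s < n * k"
proof -
  have "p * k + s < Suc p * k" using assms by simp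
  also have "\<dots> \<le> n * k" using assms by (intro mult_le_mono1) simp
  finally show ?thesis .
qed

lemma sum_div_mod:
  fixes F :: "nat \<Rightarrow> nat \<Rightarrow> real"
  shows "(\<Sum>l<n * k. F (l div k) (l mod k)) = (\<Sum>p<n. \<Sum>s<k. F p s)"
proof -
  have "(\<Sum>l<n * k. F (l div k) (l mod k)) =
      (\<Sum>p<n. \<Sum>l\<in>{p * k..<p * k + k}. F (l div k) (l mod k))"
    by (rule sum.nat_group[symmetric])
  also have "\<dots> = (\<Sum>p<n. \<Sum>s<k. F p s)"
  proof (rule sum.cong[OF refl])
    fix p
    show "(\<Sum>l\<in>{p * k..<p * k + k}. F (l div k) (l mod k)) = (\<Sum>s<k. F p s)"
      by (subst sum.atLeastLessThan_shift_0) (auto intro!: sum.cong simp: atLeast0LessThan)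
  qed
  finally show ?thesis .
qed

text \<open>
  Entry \<open>i\<close> of the product only sees the entries of \<open>z\<close> whose index has the same residue as \<open>i\<close>
  modulo \<open>k\<close>: the blow-up of \<open>A\<close> acts as \<open>k\<close> separate copies of \<open>A\<close>.
\<close>

lemma index_kron_id_mult_vec:
  assumes i: "i < dim_row A * k" and z: "dim_vec z = dim_col A * k"
  shows "((A \<otimes>\<^sub>M 1\<^sub>m k) *\<^sub>v z) $ i =
    (\<Sum>p<dim_col A. A $$ (i div k, p) * z $ (p * k + i mod k))"
proof -
  have k: "0 < k" using i by (cases k) auto
  have "((A \<otimes>\<^sub>M 1\<^sub>m k) *\<^sub>v z) $ i =
      (\<Sum>l<dim_col A * k. (A \<otimes>\<^sub>M 1\<^sub>m k) $$ (i, l) * z $ l)"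
    using i z by (simp add: scalar_prod_def atLeast0LessThan)
  also have "\<dots> = (\<Sum>l<dim_col A * k. (if i mod k = l mod k
      then A $$ (i div k, l div k) * z $ (l div k * k + l mod k) else 0))"
    using i by (intro sum.cong) (auto simp: index_kron_id)
  also have "\<dots> = (\<Sum>p<dim_col A. \<Sum>s<k. (if i mod k = s
      then A $$ (i div k, p) * z $ (p * k + s) else 0))"
    by (rule sum_div_mod)
  finally show ?thesis
    using k by simp
qed

lemma kron_id_mult_kron_ones:
  assumes "dim_col A = dim_vec x"
  shows "(A \<otimes>\<^sub>M 1\<^sub>m k) *\<^sub>v (x \<otimes>\<^sub>V ones k) = (A *\<^sub>v x) \<otimes>\<^sub>V ones k"
proof (rule eq_vecI)
  fix i
  assume "i < dim_vec ((A *\<^sub>v x) \<otimes>\<^sub>V ones k)"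
  then have i: "i < dim_row A * k" by simp
  then have k: "0 < k" by (cases k) auto
  have "p * k + i mod k < dim_vec x * k" if "p < dim_vec x" for p
    using k that by (simp add: mult_add_less)
  then show "((A \<otimes>\<^sub>M 1\<^sub>m k) *\<^sub>v (x \<otimes>\<^sub>V ones k)) $ i = ((A *\<^sub>v x) \<otimes>\<^sub>V ones k) $ i"
    using i k assms
    by (subst index_kron_id_mult_vec) (simp_all add: index_kron_ones less_mult_imp_div_less
        scalar_prod_def atLeast0LessThan)
qed simp

lemma kron_id_mult_kron_id:
  assumes "dim_col A = dim_row B"
  shows "(A \<otimes>\<^sub>M 1\<^sub>m k) * (B \<otimes>\<^sub>M 1\<^sub>m k) = (A * B) \<otimes>\<^sub>M 1\<^sub>m k"
proof (rule eq_matI)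
  fix i j
  assume "i < dim_row ((A * B) \<otimes>\<^sub>M 1\<^sub>m k)" "j < dim_col ((A * B) \<otimes>\<^sub>M 1\<^sub>m k)"
  then have ij: "i < dim_row A * k" "j < dim_col B * k" by simp_all
  then have k: "0 < k" by (cases k) auto
  have p: "p * k + i mod k < dim_row B * k" if "p < dim_row B" for p
    using k that by (simp add: mult_add_less)
  (* column by column, this is the formula for products with vectors *)
  have "((A \<otimes>\<^sub>M 1\<^sub>m k) * (B \<otimes>\<^sub>M 1\<^sub>m k)) $$ (i, j) =
      ((A \<otimes>\<^sub>M 1\<^sub>m k) *\<^sub>v col (B \<otimes>\<^sub>M 1\<^sub>m k) j) $ i"
    using ij by simp
  also have "\<dots> = (\<Sum>p<dim_row B. A $$ (i div k, p) *
      (if i mod k = j mod k then B $$ (p, j div k) else 0))"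
    using ij k p assms by (subst index_kron_id_mult_vec) (simp_all add: index_kron_id cong: if_cong)
  also have "\<dots> = ((A * B) \<otimes>\<^sub>M 1\<^sub>m k) $$ (i, j)"
    using ij assms
    by (simp add: index_kron_id less_mult_imp_div_less scalar_prod_def atLeast0LessThan)
  finally show "((A \<otimes>\<^sub>M 1\<^sub>m k) * (B \<otimes>\<^sub>M 1\<^sub>m k)) $$ (i, j) = ((A * B) \<otimes>\<^sub>M 1\<^sub>m k) $$ (i, j)" .
qed simp_all

section \<open>Matrices and vectors as blow-up systems\<close>

lemma all_mats_iff: "A \<in> all_mats \<longleftrightarrow> 0 < dim_row A \<and> 0 < dim_col A"
  by (auto simp: all_mats_def)

lemma all_vecs_iff: "x \<in> all_vecs \<longleftrightarrow> 0 < dim_vec x"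
  by (auto simp: all_vecs_def)

lemma mats_ratio_all_mats: "A \<in> mats_ratio \<mu> \<Longrightarrow> A \<in> all_mats"
  by (simp add: mats_ratio_def)

lemma M_equiv_iff: "(A, B) \<in> M_equiv \<longleftrightarrow> A \<in> all_mats \<and> B \<in> all_mats \<and>
    (\<exists>\<alpha>>0. \<exists>\<beta>>0. A \<otimes>\<^sub>M 1\<^sub>m \<alpha> = B \<otimes>\<^sub>M 1\<^sub>m \<beta>)"
  by (simp add: M_equiv_def Suc_le_eq)

lemma V_equiv_iff: "(x, y) \<in> V_equiv \<longleftrightarrow> x \<in> all_vecs \<and> y \<in> all_vecs \<and>
    (\<exists>\<alpha>>0. \<exists>\<beta>>0. x \<otimes>\<^sub>V ones \<alpha> = y \<otimes>\<^sub>V ones \<beta>)"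
  by (simp add: V_equiv_def Suc_le_eq)

lemma mats_ratio_kron_id_iff:
  assumes "0 < k"
  shows "A \<otimes>\<^sub>M 1\<^sub>m k \<in> mats_ratio \<mu> \<longleftrightarrow> A \<in> mats_ratio \<mu>"
  using assms by (auto simp: mats_ratio_def all_mats_iff)

lemma mats_ratio_M_equiv: "(A, B) \<in> M_equiv \<Longrightarrow> A \<in> mats_ratio \<mu> \<longleftrightarrow> B \<in> mats_ratio \<mu>"
  by (metis M_equiv_iff mats_ratio_kron_id_iff)

text \<open>
  Hence the number of rows alone can serve as the size of a matrix of given ratio.
\<close>

lemma mats_ratio_dim_col:
  assumes "A \<in> mats_ratio \<mu>" "B \<in> mats_ratio \<mu>" "dim_row A = dim_row B"
  shows "dim_col A = dim_col B"
  using assms by (auto simp: mats_ratio_def all_mats_iff field_simps)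

lemma kron_ones_add:
  "dim_vec x = dim_vec y \<Longrightarrow> x \<otimes>\<^sub>V ones k + y \<otimes>\<^sub>V ones k = (x + y) \<otimes>\<^sub>V ones k"
  by (rule eq_vecI) (simp_all add: index_kron_ones less_mult_imp_div_less)

lemma kron_ones_minus:
  "dim_vec x = dim_vec y \<Longrightarrow> x \<otimes>\<^sub>V ones k - y \<otimes>\<^sub>V ones k = (x - y) \<otimes>\<^sub>V ones k"
  by (rule eq_vecI) (simp_all add: index_kron_ones less_mult_imp_div_less)

lemma kron_ones_uminus: "(- x) \<otimes>\<^sub>V ones k = - (x \<otimes>\<^sub>V ones k)"
  by (rule eq_vecI) (simp_all add: index_kron_ones less_mult_imp_div_less)

lemma kron_ones_smult: "a \<cdot>\<^sub>v (x \<otimes>\<^sub>V ones k) = (a \<cdot>\<^sub>v x) \<otimes>\<^sub>V ones k"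
  by (rule eq_vecI) (simp_all add: index_kron_ones less_mult_imp_div_less)

lemma kron_id_add:
  "dim_row A = dim_row B \<Longrightarrow> dim_col A = dim_col B \<Longrightarrow>
    A \<otimes>\<^sub>M 1\<^sub>m k + B \<otimes>\<^sub>M 1\<^sub>m k = (A + B) \<otimes>\<^sub>M 1\<^sub>m k"
  by (rule eq_matI) (simp_all add: index_kron_id less_mult_imp_div_less)

lemma kron_id_smult: "a \<cdot>\<^sub>m (A \<otimes>\<^sub>M 1\<^sub>m k) = (a \<cdot>\<^sub>m A) \<otimes>\<^sub>M 1\<^sub>m k"
  by (rule eq_matI) (simp_all add: index_kron_id less_mult_imp_div_less)

interpretation M: expansion all_mats "\<lambda>A k. A \<otimes>\<^sub>M 1\<^sub>m k" M_equiv
  by unfold_locales (auto simp: all_mats_iff kron_id_kron_id kron_id_1 M_equiv_iff simp del: One_nat_def)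

interpretation V: expansion all_vecs "\<lambda>x k. x \<otimes>\<^sub>V ones k" V_equiv
  by unfold_locales (auto simp: all_vecs_iff kron_ones_kron_ones kron_ones_1 V_equiv_iff simp del: One_nat_def)

interpretation M_ratio: expansion "mats_ratio \<mu>" "\<lambda>A k. A \<otimes>\<^sub>M 1\<^sub>m k" M_equiv for \<mu>
proof
  show "(A, B) \<in> M_equiv \<longleftrightarrow> B \<in> mats_ratio \<mu> \<and>
      (\<exists>\<alpha>>0. \<exists>\<beta>>0. A \<otimes>\<^sub>M 1\<^sub>m \<alpha> = B \<otimes>\<^sub>M 1\<^sub>m \<beta>)" if "A \<in> mats_ratio \<mu>" for A B
    using that mats_ratio_M_equiv M_equiv_iff mats_ratio_all_mats by metis
qed (simp_all add: mats_ratio_kron_id_iff kron_id_kron_id kron_id_1 del: One_nat_def)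

interpretation M_prod: matched_operation
  all_mats "\<lambda>A k. A \<otimes>\<^sub>M 1\<^sub>m k" M_equiv all_mats "\<lambda>A k. A \<otimes>\<^sub>M 1\<^sub>m k" M_equiv
  all_mats "\<lambda>A k. A \<otimes>\<^sub>M 1\<^sub>m k" M_equiv dim_col dim_row "(*)" M_prod
  by unfold_locales (auto simp: all_mats_iff kron_id_mult_kron_id M_prod_def Let_def)

interpretation V_prod: matched_operation
  all_mats "\<lambda>A k. A \<otimes>\<^sub>M 1\<^sub>m k" M_equiv all_vecs "\<lambda>x k. x \<otimes>\<^sub>V ones k" V_equiv
  all_vecs "\<lambda>x k. x \<otimes>\<^sub>V ones k" V_equiv dim_col dim_vec "(*\<^sub>v)" V_prod
  by unfold_locales
    (auto simp: all_mats_iff all_vecs_iff kron_id_mult_kron_ones V_prod_def Let_def)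

interpretation V_minus: matched_operation
  all_vecs "\<lambda>x k. x \<otimes>\<^sub>V ones k" V_equiv all_vecs "\<lambda>x k. x \<otimes>\<^sub>V ones k" V_equiv
  all_vecs "\<lambda>x k. x \<otimes>\<^sub>V ones k" V_equiv dim_vec dim_vec "(-)" V_minus
proof
  fix x y assume "x \<in> all_vecs" "y \<in> all_vecs"
  let ?t = "lcm (dim_vec x) (dim_vec y)"
  have "dim_vec (x \<otimes>\<^sub>V ones (?t div dim_vec x)) = dim_vec (y \<otimes>\<^sub>V ones (?t div dim_vec y))"
    by simp
  then show "V_minus x y =
      x \<otimes>\<^sub>V ones (?t div dim_vec x) - y \<otimes>\<^sub>V ones (?t div dim_vec y)"
    unfolding V_minus_def V_add_def Let_def kron_ones_uminus
    by (intro eq_vecI) (simp_all add: kron_ones_uminus)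
qed (auto simp: all_vecs_iff kron_ones_minus)

interpretation V: expansion_vectorspace
  all_vecs "\<lambda>x k. x \<otimes>\<^sub>V ones k" V_equiv dim_vec "(+)" V_add "(\<cdot>\<^sub>v)" "V_equiv `` {0\<^sub>v 1}"
proof
  fix x :: "real vec" assume x: "x \<in> all_vecs"
  have "0 \<cdot>\<^sub>v x = 0\<^sub>v 1 \<otimes>\<^sub>V ones (dim_vec x)"
    by (rule eq_vecI) (simp_all add: index_kron_ones)
  moreover have "(0\<^sub>v 1 :: real vec) \<in> all_vecs"
    by (simp add: all_vecs_iff)
  ultimately show "V_equiv `` {0\<^sub>v 1} = V_equiv `` {0 \<cdot>\<^sub>v x}"
    using V.class_expand x by (simp add: all_vecs_iff)
next
  have "(0\<^sub>v 1 :: real vec) \<in> all_vecs"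
    by (simp add: all_vecs_iff)
  then show "all_vecs \<noteq> {}" by blast
next
  show "a \<cdot>\<^sub>v (x + y) = a \<cdot>\<^sub>v x + a \<cdot>\<^sub>v y" if "dim_vec x = dim_vec y" for a :: real and x y
    using that by (intro eq_vecI) (simp_all add: algebra_simps)
  show "(x + y) + z = x + (y + z)" if "dim_vec x = dim_vec y" "dim_vec y = dim_vec z"
    for x y z :: "real vec"
    using that by (intro eq_vecI) simp_all
  show "x + y = y + x" if "dim_vec x = dim_vec y" for x y :: "real vec"
    using that by (intro eq_vecI) simp_all
qed (auto simp: all_vecs_iff kron_ones_add kron_ones_smult V_add_def Let_def add_smult_distrib_vec smult_smult_assoc)

lemma mats_ratio_eq:
  assumes "A \<in> mats_ratio \<mu>" "B \<in> mats_ratio \<mu>"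
  shows "dim_row A * dim_col B = dim_row B * dim_col A"
proof -
  have "of_nat (dim_row A * dim_col B) = (of_nat (dim_row B * dim_col A) :: rat)"
    using assms by (auto simp: mats_ratio_def all_mats_iff field_simps)
  then show ?thesis
    using of_nat_eq_iff by blast
qed

lemma mats_ratio_nonempty:
  assumes "\<mu> > 0"
  shows "mats_ratio \<mu> \<noteq> {}"
proof -
  obtain a b where ab: "\<mu> = Rat.Fract a b" "0 < b"
    by (meson Rat_cases)
  then have a: "0 < a"
    using assms by (simp add: Rat.zero_less_Fract_iff)
  have "0\<^sub>m (nat a) (nat b) \<in> mats_ratio \<mu>"
    using a ab by (simp add: mats_ratio_def all_mats_iff Fract_of_int_quotient)
  then show ?thesis by blast
qed

text \<open>
  Two zero matrices of the same ratio become equal when each is blown up by the number of rows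
  of the other, so the union that defines the zero of the space is one class.
\<close>

lemma zero_class_ratio:
  assumes A: "A \<in> mats_ratio \<mu>"
  shows "\<Union>{M_equiv `` {0\<^sub>m m n} | m n. 0\<^sub>m m n \<in> mats_ratio \<mu>} = M_equiv `` {0 \<cdot>\<^sub>m A}"
proof -
  have A0: "0 \<cdot>\<^sub>m A = 0\<^sub>m (dim_row A) (dim_col A)"
    by (rule eq_matI) simp_all
  have A': "0\<^sub>m (dim_row A) (dim_col A) \<in> mats_ratio \<mu>"
    using A by (simp add: mats_ratio_def all_mats_iff)
  have "M_equiv `` {0\<^sub>m m n} = M_equiv `` {0 \<cdot>\<^sub>m A}" if mn: "0\<^sub>m m n \<in> mats_ratio \<mu>" for m n
  proof -
    have "m * dim_col A = dim_row A * n"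
      using mats_ratio_eq[OF mn A] by simp
    then have "0\<^sub>m m n \<otimes>\<^sub>M 1\<^sub>m (dim_row A) = 0\<^sub>m (dim_row A) (dim_col A) \<otimes>\<^sub>M 1\<^sub>m m"
      by (intro eq_matI) (simp_all add: index_kron_id less_mult_imp_div_less mult.commute)
    moreover have "0 < m" "0 < dim_row A"
      using mn A by (simp_all add: mats_ratio_def all_mats_iff)
    ultimately show ?thesis
      unfolding A0 using M_ratio.class_expand[OF mn] M_ratio.class_expand[OF A'] by metis
  qed
  then show ?thesis
    using A' unfolding A0 by blast
qed

lemma M_ratio_vectorspace:
  assumes "\<mu> > 0"
  shows "expansion_vectorspace (mats_ratio \<mu>) (\<lambda>A k. A \<otimes>\<^sub>M 1\<^sub>m k) M_equiv dim_row (+) M_add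
    (\<cdot>\<^sub>m) (\<Union>{M_equiv `` {0\<^sub>m m n} | m n. 0\<^sub>m m n \<in> mats_ratio \<mu>})"
proof
  fix A B assume A: "A \<in> mats_ratio \<mu>" and B: "B \<in> mats_ratio \<mu>"
  show "M_add A B = A \<otimes>\<^sub>M 1\<^sub>m (lcm (dim_row A) (dim_row B) div dim_row A) +
      B \<otimes>\<^sub>M 1\<^sub>m (lcm (dim_row A) (dim_row B) div dim_row B)"
    by (simp add: M_add_def Let_def)
  assume d: "dim_row A = dim_row B"
  with A B have d': "dim_col A = dim_col B" by (rule mats_ratio_dim_col)
  show "A + B \<in> mats_ratio \<mu>"
    using A d d' by (simp add: mats_ratio_def all_mats_iff)
  show "A \<otimes>\<^sub>M 1\<^sub>m k + B \<otimes>\<^sub>M 1\<^sub>m k = (A + B) \<otimes>\<^sub>M 1\<^sub>m k" for k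
    using d d' by (rule kron_id_add)
  show "A + B = B + A"
    using d d' by (intro eq_matI) simp_all
  show "dim_row (A + B) = dim_row A"
    using d by simp
  show "a \<cdot>\<^sub>m (A + B) = a \<cdot>\<^sub>m A + a \<cdot>\<^sub>m B" for a
    using d d' by (intro eq_matI) (simp_all add: algebra_simps)
  fix C assume C: "C \<in> mats_ratio \<mu>" and e: "dim_row B = dim_row C"
  then have "dim_col B = dim_col C" by (rule mats_ratio_dim_col[OF B])
  then show "A + B + C = A + (B + C)"
    using d d' e by (intro eq_matI) simp_all
next
  fix A assume A: "A \<in> mats_ratio \<mu>"
  show "a \<cdot>\<^sub>m A \<in> mats_ratio \<mu>" for a
    using A by (simp add: mats_ratio_def all_mats_iff)
  show "(a + b) \<cdot>\<^sub>m A = a \<cdot>\<^sub>m A + b \<cdot>\<^sub>m A" for a b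
    by (intro eq_matI) (simp_all add: algebra_simps)
  show "(a * b) \<cdot>\<^sub>m A = a \<cdot>\<^sub>m (b \<cdot>\<^sub>m A)" for a b
    by (intro eq_matI) simp_all
  show "1 \<cdot>\<^sub>m A = A"
    by (intro eq_matI) simp_all
  show "0 < dim_row A"
    using A by (simp add: mats_ratio_def all_mats_iff)
next
  show "mats_ratio \<mu> \<noteq> {}"
    by (rule mats_ratio_nonempty[OF assms])
qed (simp_all add: kron_id_smult zero_class_ratio)

lemma Omega_simps [simp]:
  "carrier Omega = all_vecs // V_equiv"
  "add Omega = lift_class2 V_equiv V_add"
  "smult Omega = (\<lambda>a. lift_class V_equiv (\<lambda>x. a \<cdot>\<^sub>v x))"
  by (simp_all add: Omega_def)

lemma Omega_vectorspace: "vectorspace class_ring Omega"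
  unfolding Omega_def by (rule V.quotient_vectorspace)

lemma Sigma_ratio_vectorspace: "\<mu> > 0 \<Longrightarrow> vectorspace class_ring (Sigma_ratio \<mu>)"
  unfolding Sigma_ratio_def
  by (rule expansion_vectorspace.quotient_vectorspace[OF M_ratio_vectorspace])

section \<open>The monoid of matrix classes and its action\<close>

text \<open>
  The unit can be represented by an identity matrix of whatever size fits the other factor.
\<close>

lemma one_class:
  assumes k: "0 < k"
  shows "M_equiv `` {1\<^sub>m 1} = M_equiv `` {1\<^sub>m k}"
proof -
  have "1\<^sub>m 1 \<otimes>\<^sub>M 1\<^sub>m k = (1\<^sub>m k :: real mat)"
    by (rule eq_matI) (simp_all add: index_kron_id)
  moreover have "(1\<^sub>m 1 :: real mat) \<in> all_mats"
    by (simp add: all_mats_iff)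
  ultimately show ?thesis
    using M.class_expand[of "1\<^sub>m 1" k] k by simp
qed

lemmas class_mult = M_prod.lift_matched
lemmas class_act = V_prod.lift_matched[folded action_def]

lemma mult_mat_in: "A \<in> all_mats \<Longrightarrow> B \<in> all_mats \<Longrightarrow> A * B \<in> all_mats"
  by (simp add: all_mats_iff)

lemma mult_vec_in: "A \<in> all_mats \<Longrightarrow> A *\<^sub>v x \<in> all_vecs"
  by (simp add: all_mats_iff all_vecs_iff)

lemma Sigma_monoid: "monoid Sigma_monoid"
proof (rule monoidI; simp add: Sigma_monoid_def)
  fix X Y assume "X \<in> all_mats // M_equiv" "Y \<in> all_mats // M_equiv"
  then show "lift_class2 M_equiv M_prod X Y \<in> all_mats // M_equiv"
    by (rule M_prod.lift_closed)
next
  show "M_equiv `` {1\<^sub>m (Suc 0)} \<in> all_mats // M_equiv"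
    by (rule M.class_in) (simp add: all_mats_iff)
next
  fix X Y Z assume X: "X \<in> all_mats // M_equiv" and Y: "Y \<in> all_mats // M_equiv"
    and Z: "Z \<in> all_mats // M_equiv"
  obtain A B where AB: "A \<in> all_mats" "B \<in> all_mats" "dim_col A = dim_row B"
      "X = M_equiv `` {A}" "Y = M_equiv `` {B}"
    using M_prod.matched_reps[OF X Y] .
  obtain C where C: "C \<in> all_mats" "Z = M_equiv `` {C}"
    using Z by (rule quotientE)
  (* A and B already fit; a common blow-up of both preserves this and makes room for C *)
  define A' B' C' where "A' = A \<otimes>\<^sub>M 1\<^sub>m (dim_row C)" and "B' = B \<otimes>\<^sub>M 1\<^sub>m (dim_row C)"
    and "C' = C \<otimes>\<^sub>M 1\<^sub>m (dim_col B)"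
  have in': "A' \<in> all_mats" "B' \<in> all_mats" "C' \<in> all_mats"
    and dims: "dim_col A' = dim_row B'" "dim_col B' = dim_row C'"
    using AB C by (simp_all add: all_mats_iff A'_def B'_def C'_def)
  have "X = M_equiv `` {A'}" "Y = M_equiv `` {B'}" "Z = M_equiv `` {C'}"
    using AB C by (simp_all add: A'_def B'_def C'_def M.class_expand all_mats_iff)
  moreover have "A' * B' * C' = A' * (B' * C')"
    by (rule assoc_mult_mat) (use dims in \<open>auto intro: carrier_matI\<close>)
  ultimately show "lift_class2 M_equiv M_prod (lift_class2 M_equiv M_prod X Y) Z =
      lift_class2 M_equiv M_prod X (lift_class2 M_equiv M_prod Y Z)"
    using in' dims by (simp add: class_mult mult_mat_in)
next
  fix X assume "X \<in> all_mats // M_equiv"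
  then obtain A where A: "A \<in> all_mats" "X = M_equiv `` {A}"
    by (rule quotientE)
  have d: "0 < dim_row A" "0 < dim_col A"
    using A by (simp_all add: all_mats_iff)
  then have pos: "1\<^sub>m (dim_row A) \<in> all_mats" "1\<^sub>m (dim_col A) \<in> all_mats"
    by (simp_all add: all_mats_iff)
  note one = d[THEN one_class, unfolded One_nat_def]
  show "lift_class2 M_equiv M_prod (M_equiv `` {1\<^sub>m (Suc 0)}) X = X"
    using A pos by (simp add: one(1) class_mult)
  show "lift_class2 M_equiv M_prod X (M_equiv `` {1\<^sub>m (Suc 0)}) = X"
    using A pos by (simp add: one(2) class_mult)
qed

lemma Sigma_action: "S_system Sigma_monoid action (carrier Omega)"
  unfolding S_system_def
proof (intro conjI ballI)
  show "monoid Sigma_monoid" by (rule Sigma_monoid)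
  show "carrier Omega \<noteq> {}"
    using V.class_in V.U_nonempty by auto
next
  fix s x assume "s \<in> carrier Sigma_monoid" "x \<in> carrier Omega"
  then show "action s x \<in> carrier Omega"
    unfolding action_def by (simp add: Sigma_monoid_def V_prod.lift_closed)
next
  fix X Y x assume "X \<in> carrier Sigma_monoid" "Y \<in> carrier Sigma_monoid" "x \<in> carrier Omega"
  then have X: "X \<in> all_mats // M_equiv" and Y: "Y \<in> all_mats // M_equiv"
    and x: "x \<in> all_vecs // V_equiv" by (simp_all add: Sigma_monoid_def)
  obtain A B where AB: "A \<in> all_mats" "B \<in> all_mats" "dim_col A = dim_row B"
      "X = M_equiv `` {A}" "Y = M_equiv `` {B}"
    using M_prod.matched_reps[OF X Y] .
  obtain v where v: "v \<in> all_vecs" "x = V_equiv `` {v}"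
    using x by (rule quotientE)
  define A' B' v' where "A' = A \<otimes>\<^sub>M 1\<^sub>m (dim_vec v)" and "B' = B \<otimes>\<^sub>M 1\<^sub>m (dim_vec v)"
    and "v' = v \<otimes>\<^sub>V ones (dim_col B)"
  have in': "A' \<in> all_mats" "B' \<in> all_mats" "v' \<in> all_vecs"
    and dims: "dim_col A' = dim_row B'" "dim_col B' = dim_vec v'"
    using AB v by (simp_all add: all_mats_iff all_vecs_iff A'_def B'_def v'_def)
  have "X = M_equiv `` {A'}" "Y = M_equiv `` {B'}" "x = V_equiv `` {v'}"
    using AB v by (simp_all add: A'_def B'_def v'_def M.class_expand V.class_expand
        all_mats_iff all_vecs_iff)
  moreover have "(A' * B') *\<^sub>v v' = A' *\<^sub>v (B' *\<^sub>v v')"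
    by (rule assoc_mult_mat_vec) (use dims in \<open>auto intro: carrier_matI carrier_vecI\<close>)
  ultimately show "action X (action Y x) = action (X \<otimes>\<^bsub>Sigma_monoid\<^esub> Y) x"
    using in' dims by (simp add: Sigma_monoid_def class_mult class_act mult_mat_in mult_vec_in)
next
  fix x assume "x \<in> carrier Omega"
  then have "x \<in> all_vecs // V_equiv" by simp
  then obtain v where v: "v \<in> all_vecs" "x = V_equiv `` {v}"
    by (rule quotientE)
  then show "action \<one>\<^bsub>Sigma_monoid\<^esub> x = x"
    using one_class[of "dim_vec v"]
    by (simp add: Sigma_monoid_def class_act all_vecs_iff all_mats_iff)
qed

lemma action_matched_reps:
  assumes X: "X \<in> all_mats // M_equiv" and x: "x \<in> all_vecs // V_equiv"
    and y: "y \<in> all_vecs // V_equiv"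
  obtains A v w where "A \<in> all_mats" "v \<in> all_vecs" "w \<in> all_vecs"
    "dim_col A = dim_vec v" "dim_vec w = dim_vec v"
    "X = M_equiv `` {A}" "x = V_equiv `` {v}" "y = V_equiv `` {w}"
proof -
  obtain v w where vw: "v \<in> all_vecs" "w \<in> all_vecs" "dim_vec v = dim_vec w"
      "x = V_equiv `` {v}" "y = V_equiv `` {w}"
    using V.matched_reps[OF x y] .
  obtain A where A: "A \<in> all_mats" "X = M_equiv `` {A}"
    using X by (rule quotientE)
  show thesis
    using A vw
    by (intro that[of "A \<otimes>\<^sub>M 1\<^sub>m (dim_vec v)" "v \<otimes>\<^sub>V ones (dim_col A)" "w \<otimes>\<^sub>V ones (dim_col A)"])
      (simp_all add: all_mats_iff all_vecs_iff M.class_expand V.class_expand)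
qed

lemma action_linear:
  assumes X: "X \<in> all_mats // M_equiv" and x: "x \<in> all_vecs // V_equiv"
    and y: "y \<in> all_vecs // V_equiv"
  shows "action X (a \<odot>\<^bsub>Omega\<^esub> x \<oplus>\<^bsub>Omega\<^esub> b \<odot>\<^bsub>Omega\<^esub> y) =
    a \<odot>\<^bsub>Omega\<^esub> action X x \<oplus>\<^bsub>Omega\<^esub> b \<odot>\<^bsub>Omega\<^esub> action X y"
proof -
  obtain A v w where *: "A \<in> all_mats" "v \<in> all_vecs" "w \<in> all_vecs"
    "dim_col A = dim_vec v" "dim_vec w = dim_vec v"
    "X = M_equiv `` {A}" "x = V_equiv `` {v}" "y = V_equiv `` {w}"
    using action_matched_reps[OF assms] .
  have "A *\<^sub>v (a \<cdot>\<^sub>v v + b \<cdot>\<^sub>v w) = a \<cdot>\<^sub>v (A *\<^sub>v v) + b \<cdot>\<^sub>v (A *\<^sub>v w)"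
    by (subst mult_add_distrib_mat_vec[where nr = "dim_row A" and nc = "dim_vec v"])
      (use * in \<open>auto intro!: carrier_matI carrier_vecI simp: mult_mat_vec\<close>)
  with * show ?thesis
    by (simp add: V.lift_sm V.lift_matched class_act all_vecs_iff all_mats_iff)
qed

section \<open>The distance\<close>

text \<open>
  A Euclidean norm divided by a constant for each size: the triangle inequality and definiteness
  are inherited on representatives of a common size.
\<close>

lemma V_norm_L2_set: "V_norm x = L2_set (\<lambda>i. x $ i) {..<dim_vec x} / sqrt (real (dim_vec x))"
  by (simp add: V_norm_def L2_set_def scalar_prod_def atLeast0LessThan power2_eq_square
      real_sqrt_divide)

text \<open>
  Blowing up repeats every entry \<open>k\<close> times, which does not change the mean of the squares.
\<close>

lemma V_norm_kron_ones:
  assumes "0 < k"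
  shows "V_norm (x \<otimes>\<^sub>V ones k) = V_norm x"
proof -
  have "(\<Sum>i<dim_vec x * k. (x $ (i div k))\<^sup>2) = (\<Sum>p<dim_vec x. \<Sum>s<k. (x $ p)\<^sup>2)"
    by (rule sum_div_mod)
  also have "\<dots> = real k * (\<Sum>p<dim_vec x. (x $ p)\<^sup>2)"
    by (simp add: sum_distrib_left)
  finally show ?thesis
    using assms
    by (simp add: V_norm_L2_set L2_set_def index_kron_ones real_sqrt_mult)
qed

lemma class_norm_eq:
  assumes x: "x \<in> all_vecs"
  shows "class_norm (V_equiv `` {x}) = V_norm x"
proof -
  have norm: "V_norm y = V_norm x" if xy: "(x, y) \<in> V_equiv" for y
  proof -
    obtain \<alpha> \<beta> where "0 < \<alpha>" "0 < \<beta>" "x \<otimes>\<^sub>V ones \<alpha> = y \<otimes>\<^sub>V ones \<beta>"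
      using xy unfolding V_equiv_iff by blast
    then show ?thesis
      using V_norm_kron_ones[of \<alpha> x] V_norm_kron_ones[of \<beta> y] by simp
  qed
  have "V_norm ` (V_equiv `` {x}) = (\<lambda>_. V_norm x) ` (V_equiv `` {x})"
    by (intro image_cong refl norm) simp
  also have "\<dots> = {V_norm x}"
    using V.rel_refl[OF x] by auto
  finally have "V_norm ` (V_equiv `` {x}) = {V_norm x}" .
  then show ?thesis
    by (simp add: class_norm_def)
qed

lemma class_dist_eq:
  assumes "x \<in> all_vecs" "y \<in> all_vecs" "dim_vec x = dim_vec y"
  shows "class_dist (V_equiv `` {x}) (V_equiv `` {y}) = V_norm (x - y)"
proof -
  have "x - y \<in> all_vecs" using assms by (simp add: all_vecs_iff)
  then show ?thesis
    using assms by (simp add: class_dist_def V.class_in V_minus.lift_matched class_norm_eq)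
qed

lemma V_norm_nonneg: "0 \<le> V_norm x"
  by (simp add: V_norm_L2_set)

interpretation Omega: Metric_space "carrier Omega" class_dist
proof
  fix X Y
  show "0 \<le> class_dist X Y"
  proof (cases "X \<in> all_vecs // V_equiv \<and> Y \<in> all_vecs // V_equiv")
    case True
    then obtain x y where "x \<in> all_vecs" "y \<in> all_vecs" "dim_vec x = dim_vec y"
      "X = V_equiv `` {x}" "Y = V_equiv `` {y}"
      using V.matched_reps[of X Y] by blast
    then show ?thesis by (simp add: class_dist_eq V_norm_nonneg)
  qed (auto simp: class_dist_def)
  show "class_dist X Y = class_dist Y X"
  proof (cases "X \<in> all_vecs // V_equiv \<and> Y \<in> all_vecs // V_equiv")
    case True
    then obtain x y where xy: "x \<in> all_vecs" "y \<in> all_vecs" "dim_vec x = dim_vec y"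
      "X = V_equiv `` {x}" "Y = V_equiv `` {y}"
      using V.matched_reps[of X Y] by blast
    then have "V_norm (x - y) = V_norm (y - x)"
      by (auto simp: V_norm_L2_set L2_set_def power2_commute intro!: sum.cong)
    then show ?thesis using xy by (simp add: class_dist_eq)
  qed (auto simp: class_dist_def)
next
  fix X Y assume "X \<in> carrier Omega" "Y \<in> carrier Omega"
  then obtain x y where xy: "x \<in> all_vecs" "y \<in> all_vecs" "dim_vec x = dim_vec y"
      "X = V_equiv `` {x}" "Y = V_equiv `` {y}"
    using V.matched_reps[of X Y] unfolding Omega_simps(1) by blast
  have n: "0 < dim_vec y" using xy by (simp add: all_vecs_iff)
  show "class_dist X Y = 0 \<longleftrightarrow> X = Y"
  proof
    assume "class_dist X Y = 0"
    then have "L2_set (\<lambda>i. (x - y) $ i) {..<dim_vec y} = 0"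
      using xy n by (auto simp: class_dist_eq V_norm_L2_set)
    then have "x = y"
      using xy by (intro eq_vecI) (simp_all add: L2_set_eq_0_iff)
    then show "X = Y" using xy by simp
  next
    assume "X = Y"
    show "class_dist X Y = 0"
      unfolding \<open>X = Y\<close>[symmetric] xy(4) class_dist_eq[OF xy(1) xy(1) refl]
      by (simp add: V_norm_L2_set L2_set_def)
  qed
next
  fix X Y Z assume "X \<in> carrier Omega" "Y \<in> carrier Omega" "Z \<in> carrier Omega"
  then obtain x y z where xyz: "x \<in> all_vecs" "y \<in> all_vecs" "z \<in> all_vecs"
      "dim_vec y = dim_vec x" "dim_vec z = dim_vec x"
      "X = V_equiv `` {x}" "Y = V_equiv `` {y}" "Z = V_equiv `` {z}"
    using V.matched_reps3[of X Y Z] unfolding Omega_simps(1) by blast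
  have "L2_set (\<lambda>i. (x - z) $ i) {..<dim_vec x} =
      L2_set (\<lambda>i. (x - y) $ i + (y - z) $ i) {..<dim_vec x}"
    using xyz by (intro L2_set_cong) auto
  also have "\<dots> \<le> L2_set (\<lambda>i. (x - y) $ i) {..<dim_vec x} + L2_set (\<lambda>i. (y - z) $ i) {..<dim_vec x}"
    by (rule L2_set_triangle_ineq)
  finally have "V_norm (x - z) \<le> V_norm (x - y) + V_norm (y - z)"
    using xyz by (simp add: V_norm_L2_set divide_right_mono flip: add_divide_distrib)
  then show "class_dist X Z \<le> class_dist X Y + class_dist Y Z"
    using xyz by (simp add: class_dist_eq)
qed

text \<open>
  The point of this bound is that its constant does not involve \<open>k\<close>.  Cauchy-Schwarz bounds
  the square of each entry of the product by the squared Frobenius norm of \<open>A\<close> times the squared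
  norm of the subvector of \<open>z\<close> with the same residue modulo \<open>k\<close>; each subvector is met
  once for every row of \<open>A\<close>, and the means over \<open>m * k\<close> and \<open>n * k\<close> entries cancel \<open>k\<close>.
\<close>

lemma V_norm_kron_id_mult_le:
  assumes A: "A \<in> all_mats" and k: "0 < k" and z: "dim_vec z = dim_col A * k"
  shows "V_norm ((A \<otimes>\<^sub>M 1\<^sub>m k) *\<^sub>v z) \<le>
    sqrt (dim_col A * (\<Sum>q<dim_row A. \<Sum>p<dim_col A. (A $$ (q, p))\<^sup>2)) * V_norm z"
proof -
  define m n where "m = dim_row A" and "n = dim_col A"
  define c where "c = (\<Sum>q<m. \<Sum>p<n. (A $$ (q, p))\<^sup>2)"
  define S where "S = (\<Sum>l<n * k. (z $ l)\<^sup>2)"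
  have mn: "0 < m" "0 < n" using A by (simp_all add: all_mats_iff m_def n_def)
  have row: "(\<Sum>p<n. A $$ (q, p) * z $ (p * k + s))\<^sup>2 \<le> c * (\<Sum>p<n. (z $ (p * k + s))\<^sup>2)"
    if q: "q < m" for q s
  proof -
    have "(\<Sum>p<n. (A $$ (q, p))\<^sup>2) \<le> c"
      unfolding c_def using q by (intro member_le_sum) (auto intro: sum_nonneg)
    then show ?thesis
      by (intro order_trans[OF Cauchy_Schwarz_ineq_sum] mult_right_mono sum_nonneg) auto
  qed
  have "(\<Sum>i<m * k. (((A \<otimes>\<^sub>M 1\<^sub>m k) *\<^sub>v z) $ i)\<^sup>2) =
      (\<Sum>i<m * k. (\<Sum>p<n. A $$ (i div k, p) * z $ (p * k + i mod k))\<^sup>2)"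
    using z by (intro sum.cong) (simp_all add: index_kron_id_mult_vec m_def n_def del: index_mult_mat_vec)
  also have "\<dots> = (\<Sum>q<m. \<Sum>s<k. (\<Sum>p<n. A $$ (q, p) * z $ (p * k + s))\<^sup>2)"
    by (rule sum_div_mod)
  also have "\<dots> \<le> (\<Sum>q<m. \<Sum>s<k. c * (\<Sum>p<n. (z $ (p * k + s))\<^sup>2))"
    by (intro sum_mono row) simp
  also have "\<dots> = m * c * (\<Sum>s<k. \<Sum>p<n. (z $ (p * k + s))\<^sup>2)"
    by (simp add: sum_distrib_left mult.assoc)
  also have "(\<Sum>s<k. \<Sum>p<n. (z $ (p * k + s))\<^sup>2) = (\<Sum>p<n. \<Sum>s<k. (z $ (p * k + s))\<^sup>2)"
    by (rule sum.swap)
  also have "\<dots> = (\<Sum>l<n * k. (z $ (l div k * k + l mod k))\<^sup>2)"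
    by (rule sum_div_mod[symmetric])
  also have "\<dots> = S" by (simp add: S_def)
  finally have "(\<Sum>i<m * k. (((A \<otimes>\<^sub>M 1\<^sub>m k) *\<^sub>v z) $ i)\<^sup>2) / (m * k) \<le> m * c * S / (m * k)"
    by (rule divide_right_mono) simp
  also have "\<dots> = (n * c) * (S / (n * k))"
    using mn by (simp add: field_simps)
  finally have "sqrt ((\<Sum>i<m * k. (((A \<otimes>\<^sub>M 1\<^sub>m k) *\<^sub>v z) $ i)\<^sup>2) / (m * k)) \<le>
      sqrt (n * c) * sqrt (S / (n * k))"
    by (simp flip: real_sqrt_mult)
  moreover have "V_norm ((A \<otimes>\<^sub>M 1\<^sub>m k) *\<^sub>v z) =
      sqrt ((\<Sum>i<m * k. (((A \<otimes>\<^sub>M 1\<^sub>m k) *\<^sub>v z) $ i)\<^sup>2) / (m * k))"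
    by (simp add: V_norm_L2_set L2_set_def real_sqrt_divide m_def del: index_mult_mat_vec)
  moreover have "V_norm z = sqrt (S / (n * k))"
    by (simp add: V_norm_L2_set L2_set_def real_sqrt_divide z S_def n_def)
  ultimately show ?thesis
    by (simp add: c_def m_def n_def)
qed

text \<open>
  The representative \<open>A\<close> is fixed before the vectors are chosen, so that the constant
  depends on the class of matrices only; the vectors then dictate the blow-up factor of \<open>A\<close>.
\<close>

lemma action_Lipschitz:
  assumes X: "X \<in> all_mats // M_equiv"
  shows "\<exists>C. \<forall>x\<in>carrier Omega. \<forall>y\<in>carrier Omega.
    class_dist (action X x) (action X y) \<le> C * class_dist x y"
proof -
  obtain A where A: "A \<in> all_mats" "X = M_equiv `` {A}"
    using X by (rule quotientE)
  let ?C = "sqrt (dim_col A * (\<Sum>q<dim_row A. \<Sum>p<dim_col A. (A $$ (q, p))\<^sup>2))"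
  have "class_dist (action X x) (action X y) \<le> ?C * class_dist x y"
    if xy: "x \<in> carrier Omega" "y \<in> carrier Omega" for x y
  proof -
    obtain v w where vw: "v \<in> all_vecs" "w \<in> all_vecs" "dim_vec v = dim_vec w"
        "x = V_equiv `` {v}" "y = V_equiv `` {w}"
      using V.matched_reps[of x y] xy unfolding Omega_simps(1) by blast
    define k where "k = dim_vec v"
    define B v' w' where "B = A \<otimes>\<^sub>M 1\<^sub>m k" and "v' = v \<otimes>\<^sub>V ones (dim_col A)"
      and "w' = w \<otimes>\<^sub>V ones (dim_col A)"
    have k: "0 < k" using vw by (simp add: all_vecs_iff k_def)
    have in': "B \<in> all_mats" "v' \<in> all_vecs" "w' \<in> all_vecs"
      and dims: "dim_col B = dim_vec v'" "dim_vec v' = dim_vec w'"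
      using A vw k by (simp_all add: all_mats_iff all_vecs_iff k_def B_def v'_def w'_def)
    have cl: "X = M_equiv `` {B}" "x = V_equiv `` {v'}" "y = V_equiv `` {w'}"
      using A vw k by (simp_all add: k_def B_def v'_def w'_def M.class_expand V.class_expand
          all_mats_iff all_vecs_iff)
    have "B *\<^sub>v v' - B *\<^sub>v w' = B *\<^sub>v (v' - w')"
      by (rule mult_minus_distrib_mat_vec[symmetric, where nr = "dim_row B" and nc = "dim_vec v'"])
        (use dims in \<open>auto intro: carrier_matI carrier_vecI\<close>)
    then have "class_dist (action X x) (action X y) = V_norm (B *\<^sub>v (v' - w'))"
      using in' dims by (simp add: cl class_act class_dist_eq mult_vec_in)
    also have "\<dots> \<le> ?C * V_norm (v' - w')"
      unfolding B_def using dims A k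
      by (intro V_norm_kron_id_mult_le) (simp_all add: v'_def w'_def k_def vw)
    also have "V_norm (v' - w') = class_dist x y"
      using in' dims by (simp add: cl class_dist_eq)
    finally show ?thesis .
  qed
  then show ?thesis by blast
qed

lemma action_continuous:
  assumes X: "X \<in> all_mats // M_equiv"
  shows "continuous_map Omega_topology Omega_topology (action X)"
proof -
  have "Lipschitz_continuous_map (metric (carrier Omega, class_dist))
      (metric (carrier Omega, class_dist)) (action X)"
    unfolding Lipschitz_continuous_map_def Omega.mspace_metric Omega.mdist_metric
    using action_Lipschitz[OF X] X V_prod.lift_closed[folded action_def] by auto
  from Lipschitz_continuous_imp_continuous_map[OF this] show ?thesis
    by (simp add: mtopology_of_def Omega_topology_def Omega.mspace_metric Omega.mdist_metric
        del: Omega_simps)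
qed

section \<open>Direct sums of vector spaces\<close>

text \<open>
  All laws hold componentwise; supports stay finite because every operation sends zeros to zero.
\<close>

lemma family_direct_sum_vectorspace:
  assumes K: "field K" and V: "\<And>i. i \<in> I \<Longrightarrow> vectorspace K (V i)"
  shows "vectorspace K (family_direct_sum I V)"
proof -
  have mod: "module K (V i)" if "i \<in> I" for i
    using V[OF that] by (simp add: vectorspace_def)
  have ag: "abelian_group (V i)" if "i \<in> I" for i
    using mod[OF that] by (simp add: module_def)
  have am: "abelian_monoid (V i)" if "i \<in> I" for i
    using ag[OF that] by (rule abelian_group.axioms)
  note add = abelian_monoid.a_closed[OF am] abelian_monoid.a_assoc[OF am]
    abelian_monoid.a_comm[OF am] abelian_monoid.zero_closed[OF am] abelian_monoid.l_zero[OF am]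
    abelian_group.a_inv_closed[OF ag] abelian_group.l_neg[OF ag]
  note smult = module.smult_closed[OF mod] module.smult_l_distr[OF mod]
    module.smult_r_distr[OF mod] module.smult_assoc1[OF mod] module.smult_one[OF mod]
    module.smult_r_null[OF mod]
  have minus_zero: "\<ominus>\<^bsub>V i\<^esub> \<zero>\<^bsub>V i\<^esub> = \<zero>\<^bsub>V i\<^esub>" if "i \<in> I" for i
    using abelian_group.l_neg[OF ag[OF that] add(4)[OF that]]
      abelian_monoid.r_zero[OF am[OF that] add(6)[OF that add(4)[OF that]]] by simp
  let ?S = "family_direct_sum I V"
  have in_S: "f \<in> carrier ?S \<longleftrightarrow> f \<in> extensional I \<and> (\<forall>i\<in>I. f i \<in> carrier (V i)) \<and>
      finite {i \<in> I. f i \<noteq> \<zero>\<^bsub>V i\<^esub>}" for f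
    by (auto simp: family_direct_sum_def PiE_iff)
  have ops: "add ?S f g = (\<lambda>i\<in>I. f i \<oplus>\<^bsub>V i\<^esub> g i)" "\<zero>\<^bsub>?S\<^esub> = (\<lambda>i\<in>I. \<zero>\<^bsub>V i\<^esub>)"
    "smult ?S a f = (\<lambda>i\<in>I. a \<odot>\<^bsub>V i\<^esub> f i)" for f g a
    by (simp_all add: family_direct_sum_def)
  have f_eqI: "f = g" if "f \<in> extensional I" "g \<in> extensional I" "\<And>i. i \<in> I \<Longrightarrow> f i = g i" for f g
    using that by (rule extensionalityI)
  have "abelian_group ?S"
  proof (rule abelian_groupI)
    fix f g assume f: "f \<in> carrier ?S" and g: "g \<in> carrier ?S"
    have "finite {i \<in> I. f i \<oplus>\<^bsub>V i\<^esub> g i \<noteq> \<zero>\<^bsub>V i\<^esub>}"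
      by (rule finite_subset[of _ "{i \<in> I. f i \<noteq> \<zero>\<^bsub>V i\<^esub>} \<union> {i \<in> I. g i \<noteq> \<zero>\<^bsub>V i\<^esub>}"])
        (use f g in \<open>auto simp: in_S add\<close>)
    then show "f \<oplus>\<^bsub>?S\<^esub> g \<in> carrier ?S"
      using f g by (simp add: in_S ops add cong: conj_cong)
    show "f \<oplus>\<^bsub>?S\<^esub> g = g \<oplus>\<^bsub>?S\<^esub> f"
      unfolding ops using f g by (intro restrict_ext) (simp add: in_S add(3))
    fix h assume h: "h \<in> carrier ?S"
    show "f \<oplus>\<^bsub>?S\<^esub> g \<oplus>\<^bsub>?S\<^esub> h = f \<oplus>\<^bsub>?S\<^esub> (g \<oplus>\<^bsub>?S\<^esub> h)"
      unfolding ops using f g h by (intro restrict_ext) (simp add: in_S add(2))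
  next
    fix f assume f: "f \<in> carrier ?S"
    show "\<zero>\<^bsub>?S\<^esub> \<oplus>\<^bsub>?S\<^esub> f = f"
      unfolding ops using f by (intro f_eqI) (simp_all add: in_S add(5))
    have "finite {i \<in> I. \<ominus>\<^bsub>V i\<^esub> f i \<noteq> \<zero>\<^bsub>V i\<^esub>}"
      by (rule finite_subset[of _ "{i \<in> I. f i \<noteq> \<zero>\<^bsub>V i\<^esub>}"]) (use f in \<open>auto simp: in_S minus_zero\<close>)
    then show "\<exists>g\<in>carrier ?S. g \<oplus>\<^bsub>?S\<^esub> f = \<zero>\<^bsub>?S\<^esub>"
      using f by (intro bexI[of _ "\<lambda>i\<in>I. \<ominus>\<^bsub>V i\<^esub> f i"])
        (auto simp: in_S ops add(6,7) cong: conj_cong intro!: restrict_ext)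
  qed (simp add: in_S ops add cong: conj_cong)
  moreover have "module_axioms K ?S"
  proof
    fix a f assume a: "a \<in> carrier K" and f: "f \<in> carrier ?S"
    have "finite {i \<in> I. a \<odot>\<^bsub>V i\<^esub> f i \<noteq> \<zero>\<^bsub>V i\<^esub>}"
      by (rule finite_subset[of _ "{i \<in> I. f i \<noteq> \<zero>\<^bsub>V i\<^esub>}"])
        (use a f in \<open>auto simp: in_S smult\<close>)
    then show "a \<odot>\<^bsub>?S\<^esub> f \<in> carrier ?S"
      using a f by (simp add: in_S ops smult cong: conj_cong)
    show "(a \<oplus>\<^bsub>K\<^esub> b) \<odot>\<^bsub>?S\<^esub> f = a \<odot>\<^bsub>?S\<^esub> f \<oplus>\<^bsub>?S\<^esub> b \<odot>\<^bsub>?S\<^esub> f" if "b \<in> carrier K" for b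
      unfolding ops using a that f by (intro restrict_ext) (simp add: in_S smult)
    show "(a \<otimes>\<^bsub>K\<^esub> b) \<odot>\<^bsub>?S\<^esub> f = a \<odot>\<^bsub>?S\<^esub> (b \<odot>\<^bsub>?S\<^esub> f)" if "b \<in> carrier K" for b
      unfolding ops using a that f by (intro restrict_ext) (simp add: in_S smult)
    show "a \<odot>\<^bsub>?S\<^esub> (f \<oplus>\<^bsub>?S\<^esub> g) = a \<odot>\<^bsub>?S\<^esub> f \<oplus>\<^bsub>?S\<^esub> a \<odot>\<^bsub>?S\<^esub> g" if "g \<in> carrier ?S" for g
      unfolding ops using a that f by (intro restrict_ext) (simp add: in_S smult)
  next
    fix f assume f: "f \<in> carrier ?S"
    show "\<one>\<^bsub>K\<^esub> \<odot>\<^bsub>?S\<^esub> f = f"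
      unfolding ops using f by (intro f_eqI) (simp_all add: in_S smult)
  qed
  ultimately show ?thesis
    using K by (auto simp: vectorspace_def module_def field_def domain_def)
qed

section \<open>The system of matrix classes acting on vector classes\<close>

lemma Sigma_carrier:
  "carrier Sigma_monoid = (\<Union>\<mu>\<in>{\<mu>. \<mu> > 0}. carrier (Sigma_ratio \<mu>))"
proof -
  have "X \<in> all_mats // M_equiv \<longleftrightarrow> (\<exists>\<mu>>0. X \<in> mats_ratio \<mu> // M_equiv)" for X
  proof
    assume "X \<in> all_mats // M_equiv"
    then obtain A where A: "A \<in> all_mats" "X = M_equiv `` {A}"
      by (rule quotientE)
    define \<mu> :: rat where "\<mu> = of_nat (dim_row A) / of_nat (dim_col A)"
    have "\<mu> > 0" "A \<in> mats_ratio \<mu>"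
      using A by (simp_all add: mats_ratio_def all_mats_iff \<mu>_def)
    then show "\<exists>\<mu>>0. X \<in> mats_ratio \<mu> // M_equiv"
      using A M_ratio.class_in by blast
  next
    assume "\<exists>\<mu>>0. X \<in> mats_ratio \<mu> // M_equiv"
    then show "X \<in> all_mats // M_equiv"
      by (metis quotientE M.class_in mats_ratio_all_mats)
  qed
  then show ?thesis
    by (auto simp: Sigma_monoid_def Sigma_ratio_def)
qed

text \<open>
  Equivalent matrices have the same ratio of rows to columns, so the ratio is an invariant of classes.
\<close>

lemma Sigma_disjoint: "disjoint_family_on (\<lambda>\<mu>. carrier (Sigma_ratio \<mu>)) I"
proof -
  have "\<mu> = \<nu>" if X: "X \<in> mats_ratio \<mu> // M_equiv" "X \<in> mats_ratio \<nu> // M_equiv" for \<mu> \<nu> X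
  proof -
    obtain A where A: "A \<in> mats_ratio \<mu>" "X = M_equiv `` {A}"
      using X(1) by (rule quotientE)
    obtain B where B: "B \<in> mats_ratio \<nu>" "X = M_equiv `` {B}"
      using X(2) by (rule quotientE)
    have "(A, B) \<in> M_equiv"
      using A B M.class_eq_iff mats_ratio_all_mats by metis
    then have "B \<in> mats_ratio \<mu>"
      using A mats_ratio_M_equiv by blast
    with B show ?thesis by (simp add: mats_ratio_def)
  qed
  then show ?thesis
    by (auto simp: disjoint_family_on_def Sigma_ratio_def)
qed

theorem mainTheorem7:
  shows "dynamic_system Sigma_monoid action (carrier Omega) Omega_topology \<and>
    linear_S_system Sigma_monoid {\<mu>. \<mu> > 0} Sigma_ratio action Omega"
proof
  show "dynamic_system Sigma_monoid action (carrier Omega) Omega_topology"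
    unfolding dynamic_system_def
    using Sigma_action action_continuous Omega.Hausdorff_space_mtopology Omega.topspace_mtopology
    by (simp add: Omega_topology_def Sigma_monoid_def)
next
  show "linear_S_system Sigma_monoid {\<mu>. \<mu> > 0} Sigma_ratio action Omega"
    unfolding linear_S_system_def
  proof (intro conjI ballI allI)
    show "vectorspace class_ring (family_direct_sum {\<mu>. \<mu> > 0} Sigma_ratio)"
      by (rule family_direct_sum_vectorspace[OF class_field]) (simp add: Sigma_ratio_vectorspace)
  next
    fix s x y a b
    assume "s \<in> carrier Sigma_monoid" "x \<in> carrier Omega" "y \<in> carrier Omega"
    then show "action s (a \<odot>\<^bsub>Omega\<^esub> x \<oplus>\<^bsub>Omega\<^esub> b \<odot>\<^bsub>Omega\<^esub> y) =
        a \<odot>\<^bsub>Omega\<^esub> action s x \<oplus>\<^bsub>Omega\<^esub> b \<odot>\<^bsub>Omega\<^esub> action s y"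
      by (intro action_linear) (simp_all add: Sigma_monoid_def)
  qed (simp_all add: Sigma_action Sigma_carrier Sigma_disjoint Sigma_ratio_vectorspace
      Omega_vectorspace del: Omega_simps)
qed

end
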